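(* Let a positive integer $B$ and two permutation classes $\mathcal{C}$ and $\mathcal{D}$ be given. Then $$ s(\mathcal{M}(\mathcal{C},\mathcal{D})) \le \left(\sqrt{s(\mathcal{C})}+\sqrt{s(\mathcal{D})}\right)^2 \quad\text{and}\quad s(\mathcal{M}_B(\mathcal{C},\mathcal{D})) = \max(s(\mathcal{C}), s(\mathcal{D})). $$
   Context: Permutations are finite and the empty permutation is allowed. A permutation $\pi$ of length $n$ is identified with the set of points $\{(1,\pi(1)),\dots,(n,\pi(n))\}$. An embedding of $\alpha$ in $\pi$ is a map $f$ from the points of $\alpha$ to the points of $\pi$ that respects both the order by first coordinate (position) and the order by second coordinate (value), i.e. $x$ precedes (is larger than) $y$ in $\alpha$ if and only if $f(x)$ precedes (is larger than) $f(y)$ in $\pi$; $\alpha$ is involved in $\pi$ if such an embedding exists. A permutation class is a set of permutations closed downward under involvement. The growth rate of a class $\mathcal{C}$ is $s(\mathcal{C})=\limsup_{n\to\infty}|\mathcal{C}\cap\mathcal{S}_n|^{1/n}$, where $\mathcal{S}_n$ is the set of permutations of length $n$. A permutation $\pi$ is a merge of $\alpha$ and $\beta$ if there are embeddings $a:\alpha\to\pi$ and $b:\beta\to\pi$ with disjoint ranges whose union is $\pi$. $\mathcal{M}(\mathcal{C},\mathcal{D})$ is the class of all permutations that are a merge of some $\alpha\in\mathcal{C}$ and some $\beta\in\mathcal{D}$. Given such a merge, the type of $x\in\pi$ is $a$ if $x$ is in the range of $a$ and $b$ if it is in the range of $b$. For $1\le c<|\pi|$ there is a type change by position at $c$ if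 $(c,\pi(c))$ and $(c+1,\pi(c+1))$ have different types; for $1\le r<|\pi|$ there is a type change by value at $r$ if $(\pi^{-1}(r),r)$ and $(\pi^{-1}(r+1),r+1)$ have different types. $\mathcal{M}_B(\mathcal{C},\mathcal{D})$ (the $B$-bounded merge of $\mathcal{C}$ and $\mathcal{D}$) is the class of all $\pi$ that are a merge of some $\alpha\in\mathcal{C}$ and some $\beta\in\mathcal{D}$ having at most $B$ type changes in total (type changes by position plus type changes by value).
   Formalization: The second claim (growth rate of the B-bounded merge) is stated for nonempty permutation classes C and D; if D is empty, the bounded merge is empty with growth rate 0, so the equality fails whenever s(C) > 0. *)

theory Defs
  imports "HOL-Analysis.Analysis" "HOL-Combinatorics.Multiset_Permutations"
begin

text \<open>Permutations are in one-line notation: a permutation of length \<open>n\<close> is a list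
  containing each of \<open>1, \<dots>, n\<close> exactly once.\<close>

definition perms :: "nat \<Rightarrow> nat list set" where
  "perms n = permutations_of_set {1..n}"

text \<open>Lists are indexed from 0, whereas positions in a permutation are numbered from 1.\<close>

definition points :: "nat list \<Rightarrow> (nat \<times> nat) set" where
  "points \<pi> = {(i, \<pi> ! (i - 1)) | i. 1 \<le> i \<and> i \<le> length \<pi>}"

definition embedding :: "nat list \<Rightarrow> nat list \<Rightarrow> (nat \<times> nat \<Rightarrow> nat \<times> nat) \<Rightarrow> bool" where
  "embedding \<alpha> \<pi> f \<longleftrightarrow>
     f \<in> points \<alpha> \<rightarrow> points \<pi> \<and>
     (\<forall>x\<in>points \<alpha>. \<forall>y\<in>points \<alpha>.
        (fst x < fst y \<longleftrightarrow> fst (f x) < fst (f y)) \<and>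
        (snd x < snd y \<longleftrightarrow> snd (f x) < snd (f y)))"

definition involved :: "nat list \<Rightarrow> nat list \<Rightarrow> bool" where
  "involved \<alpha> \<pi> \<longleftrightarrow> (\<exists>f. embedding \<alpha> \<pi> f)"

text \<open>The empty set of permutations counts as a class; every other class contains the empty
  permutation. If one of \<open>C\<close>, \<open>D\<close> is empty then so are their merges, whatever the other is.\<close>

definition perm_class :: "nat list set \<Rightarrow> bool" where
  "perm_class C \<longleftrightarrow>
     C \<subseteq> (\<Union>n. perms n) \<and>
     (\<forall>\<pi>\<in>C. \<forall>m. \<forall>\<alpha>\<in>perms m. involved \<alpha> \<pi> \<longrightarrow> \<alpha> \<in> C)"

text \<open>The growth rate is an extended real: it is infinite for the class of all permutations.\<close>

definition growth_rate :: "nat list set \<Rightarrow> ereal" where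
  "growth_rate C = limsup (\<lambda>n. ereal (root n (real (card (C \<inter> perms n)))))"

text \<open>Growth rates are nonnegative, so the values of the square root at negative arguments
  (here: the odd extension, as for \<^const>\<open>sqrt\<close>) play no role.\<close>

fun ereal_sqrt :: "ereal \<Rightarrow> ereal" where
  "ereal_sqrt (ereal x) = ereal (sqrt x)"
| "ereal_sqrt PInfty = \<infinity>"
| "ereal_sqrt MInfty = -\<infinity>"

definition is_merge ::
  "nat list \<Rightarrow> nat list \<Rightarrow> (nat \<times> nat \<Rightarrow> nat \<times> nat) \<Rightarrow> (nat \<times> nat \<Rightarrow> nat \<times> nat) \<Rightarrow>
   nat list \<Rightarrow> bool" where
  "is_merge \<alpha> \<beta> a b \<pi> \<longleftrightarrow>
     embedding \<alpha> \<pi> a \<and> embedding \<beta> \<pi> b \<and>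
     a ` points \<alpha> \<inter> b ` points \<beta> = {} \<and>
     a ` points \<alpha> \<union> b ` points \<beta> = points \<pi>"

text \<open>In the next two definitions \<open>P\<close> and \<open>Q\<close> are the ranges of the two embeddings of a merge.
  The function \<open>k\<close> is \<^const>\<open>fst\<close> for type changes by position and \<^const>\<open>snd\<close> for
  type changes by value.\<close>

definition differ_in_type ::
  "(nat \<times> nat) set \<Rightarrow> (nat \<times> nat) set \<Rightarrow> nat \<times> nat \<Rightarrow> nat \<times> nat \<Rightarrow> bool" where
  "differ_in_type P Q x y \<longleftrightarrow> x \<in> P \<and> y \<in> Q \<or> x \<in> Q \<and> y \<in> P"

definition type_changes ::
  "(nat \<times> nat \<Rightarrow> nat) \<Rightarrow> (nat \<times> nat) set \<Rightarrow> (nat \<times> nat) set \<Rightarrow> nat list \<Rightarrow> nat set" where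
  "type_changes k P Q \<pi> =
     {c. 1 \<le> c \<and> c < length \<pi> \<and>
         (\<exists>x\<in>points \<pi>. \<exists>y\<in>points \<pi>. k x = c \<and> k y = c + 1 \<and> differ_in_type P Q x y)}"

definition merge_class :: "nat list set \<Rightarrow> nat list set \<Rightarrow> nat list set" where
  "merge_class C D =
     {\<pi> \<in> (\<Union>n. perms n). \<exists>\<alpha>\<in>C. \<exists>\<beta>\<in>D. \<exists>a b. is_merge \<alpha> \<beta> a b \<pi>}"

definition bounded_merge_class ::
  "nat \<Rightarrow> nat list set \<Rightarrow> nat list set \<Rightarrow> nat list set" where
  "bounded_merge_class B C D =
     {\<pi> \<in> (\<Union>n. perms n). \<exists>\<alpha>\<in>C. \<exists>\<beta>\<in>D. \<exists>a b. is_merge \<alpha> \<beta> a b \<pi> \<and>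
        card (type_changes fst (a ` points \<alpha>) (b ` points \<beta>) \<pi>) +
        card (type_changes snd (a ` points \<alpha>) (b ` points \<beta>) \<pi>) \<le> B}"

end

theory Submission
  imports Defs
begin

text \<open>
  Let \<open>\<pi>\<close> of length \<open>n\<close> be a merge of \<open>\<alpha>\<close> and \<open>\<beta>\<close>, and let \<open>P\<close> and \<open>V\<close> be the sets of positions
  and of values occupied by the copy of \<open>\<alpha>\<close>. Then \<open>\<pi>\<close> is determined by
  \<open>(\<alpha>, \<beta>, P, V)\<close> (\<open>merge_unique\<close>): an order embedding of a finite chain of numbers is determined
  by its image, so \<open>P\<close> and \<open>V\<close> fix the copy of \<open>\<alpha>\<close>, and their complements fix the copy of \<open>\<beta>\<close>.
  Write \<open>c\<^sub>k\<close> and \<open>d\<^sub>k\<close> for the numbers of permutations of length \<open>k\<close> in \<open>C\<close> and \<open>D\<close>. A set of merges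
  of length \<open>n\<close> therefore has at most \<open>\<Sum>\<^sub>k c\<^sub>k d\<^sub>n\<^sub>-\<^sub>k w\<^sub>k\<close> elements, where \<open>w\<^sub>k\<close> counts the admissible
  pairs \<open>(P, V)\<close> for \<open>|\<alpha>| = k\<close> (\<open>card_merges_le\<close>).

  For arbitrary merges, \<open>P\<close> and \<open>V\<close> are any \<open>k\<close>-subsets of \<open>{1..n}\<close>, so \<open>w\<^sub>k\<close> is the square of a
  binomial coefficient. If \<open>x\<close> and \<open>y\<close> exceed the two growth rates, then up to constant factors
  \<open>c\<^sub>k \<le> x\<^sup>k\<close> and \<open>d\<^sub>k \<le> y\<^sup>k\<close>, and a sum of squares of nonnegative numbers is at most
  the square of their sum; the binomial theorem for \<open>(\<surd>x + \<surd>y)\<^sup>n\<close> then bounds the count by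
  a constant times \<open>(\<surd>x + \<surd>y)\<^sup>2\<^sup>n\<close>. Letting \<open>x\<close> and \<open>y\<close> tend to the growth rates gives the
  first claim.

  With at most \<open>B\<close> type changes there are only polynomially many choices of \<open>P\<close> and of \<open>V\<close>,
  because such a set is determined by where its membership changes and by whether it contains \<open>1\<close>.
  For \<open>x\<close> above both growth rates the count is then at most a polynomial times \<open>x\<^sup>n\<close>, and the
  polynomial disappears in the limit of \<open>n\<close>-th roots. The reverse inequality holds because
  merging with the empty permutation causes no type change, so both classes lie in
  their bounded merge.
\<close>

section \<open>Points of a permutation\<close>

lemma points_eq_image: "points \<pi> = (\<lambda>i. (i, \<pi> ! (i - 1))) ` {1..length \<pi>}"
  unfolding points_def by auto

lemma finite_points: "finite (points \<pi>)"
  by (simp add: points_eq_image)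

lemma card_points: "card (points \<pi>) = length \<pi>"
  unfolding points_eq_image by (subst card_image) (auto simp: inj_on_def)

lemma length_perms: "\<pi> \<in> perms n \<Longrightarrow> length \<pi> = n"
  unfolding perms_def permutations_of_set_def using distinct_card by fastforce

lemma finite_perms: "finite (perms n)"
  unfolding perms_def by simp

lemma coordinate_image_points:
  assumes "\<pi> \<in> perms n" and "k = fst \<or> k = snd"
  shows "k ` points \<pi> = {1..n}"
  using assms(2)
proof
  assume "k = fst"
  then show ?thesis
    using length_perms[OF assms(1)] by (auto simp: points_eq_image image_image)
next
  assume k: "k = snd"
  have "set \<pi> = (\<lambda>i. \<pi> ! (i - 1)) ` {1..length \<pi>}"
  proof -
    have "(\<lambda>i. \<pi> ! (i - 1)) ` Suc ` {..<length \<pi>} = (!) \<pi> ` {..<length \<pi>}"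
      by (simp add: image_image)
    moreover have "Suc ` {..<length \<pi>} = {1..length \<pi>}"
      by (simp add: image_Suc_lessThan)
    ultimately show ?thesis
      by (auto simp: set_conv_nth)
  qed
  moreover have "set \<pi> = {1..n}"
    using assms(1) unfolding perms_def permutations_of_set_def by simp
  ultimately show ?thesis
    using k by (simp add: points_eq_image image_image)
qed

lemma inj_on_coordinate_points:
  assumes "\<pi> \<in> perms n" and "k = fst \<or> k = snd"
  shows "inj_on k (points \<pi>)"
  by (rule eq_card_imp_inj_on)
     (simp_all add: finite_points coordinate_image_points[OF assms] card_points
        length_perms[OF assms(1)])

lemma points_inject:
  assumes "\<pi> \<in> perms n" and "\<pi>' \<in> perms n" and "points \<pi> = points \<pi>'"
  shows "\<pi> = \<pi>'"
proof (rule nth_equalityI)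
  show "length \<pi> = length \<pi>'"
    using assms length_perms by simp
  fix i assume "i < length \<pi>"
  then have "(Suc i, \<pi> ! i) \<in> points \<pi>"
    unfolding points_def by auto
  then have "(Suc i, \<pi> ! i) \<in> points \<pi>'"
    using assms(3) by simp
  then show "\<pi> ! i = \<pi>' ! i"
    unfolding points_def by auto
qed

section \<open>Merges are determined by their parts and their position and value sets\<close>

text \<open>At the \<open>k\<close>-least point where \<open>f\<close> and \<open>g\<close> differ, the smaller of the two values would have
  to be attained by the other function at an earlier point, where the two agree. The orders are
  induced by \<open>k\<close>, so that the lemma applies to points of a permutation ordered by either
  coordinate.\<close>
lemma order_embedding_unique:
  fixes k f g :: "'a \<Rightarrow> nat"
  assumes f: "\<forall>x\<in>X. \<forall>y\<in>X. k x < k y \<longleftrightarrow> f x < f y"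
    and g: "\<forall>x\<in>X. \<forall>y\<in>X. k x < k y \<longleftrightarrow> g x < g y"
    and img: "f ` X = g ` X" and "x \<in> X"
  shows "f x = g x"
  using \<open>x \<in> X\<close>
proof (induction "k x" arbitrary: x rule: less_induct)
  case less
  have "\<not> f x < g x"
  proof
    assume *: "f x < g x"
    obtain y where "y \<in> X" "f x = g y"
      using img less.prems by (metis image_iff)
    with * f g less show False by (metis less_irrefl)
  qed
  moreover have "\<not> g x < f x"
  proof
    assume *: "g x < f x"
    obtain y where "y \<in> X" "g x = f y"
      using img less.prems by (metis image_iff)
    with * f g less show False by (metis less_irrefl)
  qed
  ultimately show ?case by simp
qed

lemma embedding_unique:
  assumes "embedding \<alpha> \<pi> a" and "embedding \<alpha> \<pi>' a'"
    and "fst ` a ` points \<alpha> = fst ` a' ` points \<alpha>"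
    and "snd ` a ` points \<alpha> = snd ` a' ` points \<alpha>"
    and "x \<in> points \<alpha>"
  shows "a x = a' x"
proof (rule prod_eqI)
  show "fst (a x) = fst (a' x)"
    using order_embedding_unique[of "points \<alpha>" fst "fst \<circ> a" "fst \<circ> a'" x] assms
    unfolding embedding_def by (simp add: image_comp)
  show "snd (a x) = snd (a' x)"
    using order_embedding_unique[of "points \<alpha>" snd "snd \<circ> a" "snd \<circ> a'" x] assms
    unfolding embedding_def by (simp add: image_comp)
qed

lemma embedding_inj_on:
  assumes "embedding \<alpha> \<pi> a"
  shows "inj_on a (points \<alpha>)"
proof (rule inj_onI)
  fix x y assume xy: "x \<in> points \<alpha>" "y \<in> points \<alpha>" "a x = a y"
  have order: "\<And>x y. x \<in> points \<alpha> \<Longrightarrow> y \<in> points \<alpha> \<Longrightarrow>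
      (fst x < fst y \<longleftrightarrow> fst (a x) < fst (a y)) \<and> (snd x < snd y \<longleftrightarrow> snd (a x) < snd (a y))"
    using assms unfolding embedding_def by blast
  have "fst x = fst y" "snd x = snd y"
    using order[OF xy(1,2)] order[OF xy(2,1)] xy(3) by simp_all
  then show "x = y" by (rule prod_eqI)
qed

text \<open>The copies of \<open>\<alpha>\<close> and \<open>\<beta>\<close> are complementary sets of points, and each coordinate is
  a bijection from the points of \<open>\<pi>\<close> to \<open>{1..n}\<close>.\<close>
lemma merge_coordinates_second:
  assumes "is_merge \<alpha> \<beta> a b \<pi>" and "\<pi> \<in> perms n" and "k = fst \<or> k = snd"
  shows "k ` b ` points \<beta> = {1..n} - k ` a ` points \<alpha>"
proof -
  have "b ` points \<beta> = points \<pi> - a ` points \<alpha>" and "a ` points \<alpha> \<subseteq> points \<pi>"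
    using assms(1) unfolding is_merge_def by blast+
  then show ?thesis
    using inj_on_image_set_diff[OF inj_on_coordinate_points[OF assms(2,3)], of "points \<pi>" "a ` points \<alpha>"]
      coordinate_image_points[OF assms(2,3)] by auto
qed

text \<open>The position and value sets of \<open>\<alpha>\<close> fix the embedding of \<open>\<alpha>\<close>; their complements are the
  position and value sets of \<open>\<beta>\<close> and fix the embedding of \<open>\<beta>\<close>.\<close>
lemma merge_unique:
  assumes m: "is_merge \<alpha> \<beta> a b \<pi>" and m': "is_merge \<alpha> \<beta> a' b' \<pi>'"
    and p: "\<pi> \<in> perms n" and p': "\<pi>' \<in> perms n"
    and P: "fst ` a ` points \<alpha> = fst ` a' ` points \<alpha>"
    and V: "snd ` a ` points \<alpha> = snd ` a' ` points \<alpha>"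
  shows "\<pi> = \<pi>'"
proof (rule points_inject[OF p p'])
  have emb: "embedding \<alpha> \<pi> a" "embedding \<alpha> \<pi>' a'" "embedding \<beta> \<pi> b" "embedding \<beta> \<pi>' b'"
    and un: "a ` points \<alpha> \<union> b ` points \<beta> = points \<pi>"
      "a' ` points \<alpha> \<union> b' ` points \<beta> = points \<pi>'"
    using m m' by (simp_all only: is_merge_def)
  have "fst ` b ` points \<beta> = fst ` b' ` points \<beta>"
    using merge_coordinates_second[OF m p, of fst] merge_coordinates_second[OF m' p', of fst] P
    by simp
  moreover have "snd ` b ` points \<beta> = snd ` b' ` points \<beta>"
    using merge_coordinates_second[OF m p, of snd] merge_coordinates_second[OF m' p', of snd] V
    by simp
  ultimately have "b ` points \<beta> = b' ` points \<beta>"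
    by (rule image_cong[OF refl embedding_unique[OF emb(3,4)]])
  moreover have "a ` points \<alpha> = a' ` points \<alpha>"
    by (rule image_cong[OF refl embedding_unique[OF emb(1,2) P V]])
  ultimately show "points \<pi> = points \<pi>'"
    using un by simp
qed

lemma merge_coordinates_first:
  assumes "is_merge \<alpha> \<beta> a b \<pi>" and "\<pi> \<in> perms n" and "k = fst \<or> k = snd"
  shows "k ` a ` points \<alpha> \<subseteq> {1..n}" and "card (k ` a ` points \<alpha>) = length \<alpha>"
proof -
  have sub: "a ` points \<alpha> \<subseteq> points \<pi>"
    using assms(1) unfolding is_merge_def by blast
  then show "k ` a ` points \<alpha> \<subseteq> {1..n}"
    using coordinate_image_points[OF assms(2,3)] by blast
  have "inj_on k (a ` points \<alpha>)"
    using inj_on_coordinate_points[OF assms(2,3)] sub by (rule inj_on_subset)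
  moreover have "inj_on a (points \<alpha>)"
    using assms(1) by (intro embedding_inj_on[of \<alpha> \<pi>]) (simp only: is_merge_def)
  ultimately show "card (k ` a ` points \<alpha>) = length \<alpha>"
    by (simp add: card_image card_points)
qed

lemma merge_length:
  assumes "is_merge \<alpha> \<beta> a b \<pi>"
  shows "length \<alpha> + length \<beta> = length \<pi>"
proof -
  have "card (a ` points \<alpha> \<union> b ` points \<beta>) = card (a ` points \<alpha>) + card (b ` points \<beta>)"
    using assms unfolding is_merge_def by (intro card_Un_disjoint) (auto simp: finite_points)
  moreover have "card (a ` points \<alpha>) = length \<alpha>" "card (b ` points \<beta>) = length \<beta>"
    using assms embedding_inj_on unfolding is_merge_def by (metis card_image card_points)+
  ultimately show ?thesis
    using assms card_points unfolding is_merge_def by metis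
qed

lemma perm_class_in_perms:
  assumes "perm_class C" and "\<alpha> \<in> C"
  shows "\<alpha> \<in> perms (length \<alpha>)"
  using assms length_perms unfolding perm_class_def by blast

text \<open>By uniqueness, sending a merge to its two parts together with its position and value sets
  is injective. The family \<open>W\<close> lists the pairs of sets that may occur when the first part has
  length \<open>k\<close>; it is a parameter because general and bounded merges restrict these pairs
  differently.\<close>
lemma card_merges_le:
  assumes C: "perm_class C" and D: "perm_class D"
    and M: "M \<subseteq> perms n" and W: "\<And>k. finite (W k)"
    and ex: "\<And>\<pi>. \<pi> \<in> M \<Longrightarrow> \<exists>\<alpha>\<in>C. \<exists>\<beta>\<in>D. \<exists>a b. is_merge \<alpha> \<beta> a b \<pi> \<and>
        (fst ` a ` points \<alpha>, snd ` a ` points \<alpha>) \<in> W (length \<alpha>)"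
  shows "card M \<le> (\<Sum>k\<le>n. card (C \<inter> perms k) * card (D \<inter> perms (n - k)) * card (W k))"
proof -
  define X where "X = (SIGMA k:{..n}. (C \<inter> perms k) \<times> (D \<inter> perms (n - k)) \<times> W k)"
  define R where "R \<pi> t \<longleftrightarrow> (case t of (k, \<alpha>, \<beta>, P, V) \<Rightarrow>
      \<exists>a b. is_merge \<alpha> \<beta> a b \<pi> \<and> P = fst ` a ` points \<alpha> \<and> V = snd ` a ` points \<alpha>)"
    for \<pi> :: "nat list" and t :: "nat \<times> nat list \<times> nat list \<times> nat set \<times> nat set"
  have "\<exists>t. t \<in> X \<and> R \<pi> t" if "\<pi> \<in> M" for \<pi>
  proof -
    obtain \<alpha> \<beta> a b where *: "\<alpha> \<in> C" "\<beta> \<in> D" "is_merge \<alpha> \<beta> a b \<pi>"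
      "(fst ` a ` points \<alpha>, snd ` a ` points \<alpha>) \<in> W (length \<alpha>)"
      using ex[OF \<open>\<pi> \<in> M\<close>] by blast
    have "length \<alpha> + length \<beta> = n"
      using merge_length[OF *(3)] length_perms M \<open>\<pi> \<in> M\<close> by (metis subsetD)
    then have "length \<alpha> \<le> n" "n - length \<alpha> = length \<beta>" by auto
    with * perm_class_in_perms[OF C] perm_class_in_perms[OF D]
    have "(length \<alpha>, \<alpha>, \<beta>, fst ` a ` points \<alpha>, snd ` a ` points \<alpha>) \<in> X"
      unfolding X_def by auto
    moreover have "R \<pi> (length \<alpha>, \<alpha>, \<beta>, fst ` a ` points \<alpha>, snd ` a ` points \<alpha>)"
      unfolding R_def using *(3) by auto
    ultimately show ?thesis by blast
  qed
  then obtain f where f: "\<And>\<pi>. \<pi> \<in> M \<Longrightarrow> f \<pi> \<in> X" "\<And>\<pi>. \<pi> \<in> M \<Longrightarrow> R \<pi> (f \<pi>)"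
    by metis
  have "inj_on f M"
  proof (rule inj_onI)
    fix \<pi> \<pi>' assume *: "\<pi> \<in> M" "\<pi>' \<in> M" "f \<pi> = f \<pi>'"
    obtain k \<alpha> \<beta> P V where t: "f \<pi> = (k, \<alpha>, \<beta>, P, V)" by (cases "f \<pi>")
    then have "R \<pi> (k, \<alpha>, \<beta>, P, V)" "R \<pi>' (k, \<alpha>, \<beta>, P, V)"
      using f(2) * by metis+
    then obtain a b a' b' where "is_merge \<alpha> \<beta> a b \<pi>" "is_merge \<alpha> \<beta> a' b' \<pi>'"
      "fst ` a ` points \<alpha> = fst ` a' ` points \<alpha>" "snd ` a ` points \<alpha> = snd ` a' ` points \<alpha>"
      unfolding R_def by auto
    then show "\<pi> = \<pi>'"
      using * M by (intro merge_unique[of \<alpha> \<beta> a b \<pi> a' b' \<pi>' n]) auto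
  qed
  moreover have "finite X"
    unfolding X_def using W finite_perms by auto
  ultimately have "card M \<le> card X"
    using f(1) by (intro card_inj_on_le) auto
  also have "card X = (\<Sum>k\<le>n. card (C \<inter> perms k) * card (D \<inter> perms (n - k)) * card (W k))"
    unfolding X_def using W finite_perms
    by (subst card_SigmaI) (auto simp: card_cartesian_product mult.assoc)
  finally show ?thesis .
qed

section \<open>Counting position sets and value sets\<close>

lemma card_merge_class_le:
  assumes "perm_class C" and "perm_class D"
  shows "card (merge_class C D \<inter> perms n)
    \<le> (\<Sum>k\<le>n. card (C \<inter> perms k) * card (D \<inter> perms (n - k)) * (n choose k)\<^sup>2)"
proof -
  define S where "S k = {P. P \<subseteq> {1..n} \<and> card P = k}" for k
  have "card (merge_class C D \<inter> perms n)
    \<le> (\<Sum>k\<le>n. card (C \<inter> perms k) * card (D \<inter> perms (n - k)) * card (S k \<times> S k))"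
  proof (rule card_merges_le[OF assms])
    show "finite (S k \<times> S k)" for k
      unfolding S_def by simp
    fix \<pi> assume \<pi>: "\<pi> \<in> merge_class C D \<inter> perms n"
    then obtain \<alpha> \<beta> a b where *: "\<alpha> \<in> C" "\<beta> \<in> D" "is_merge \<alpha> \<beta> a b \<pi>"
      unfolding merge_class_def by blast
    moreover have "(fst ` a ` points \<alpha>, snd ` a ` points \<alpha>) \<in> S (length \<alpha>) \<times> S (length \<alpha>)"
      unfolding S_def using merge_coordinates_first[OF *(3), of n] \<pi> by simp
    ultimately show "\<exists>\<alpha>\<in>C. \<exists>\<beta>\<in>D. \<exists>a b. is_merge \<alpha> \<beta> a b \<pi> \<and>
        (fst ` a ` points \<alpha>, snd ` a ` points \<alpha>) \<in> S (length \<alpha>) \<times> S (length \<alpha>)"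
      by - (rule bexI[of _ \<alpha>], rule bexI[of _ \<beta>], rule exI[of _ a], rule exI[of _ b],
            rule conjI, assumption+)
  qed simp
  moreover have "card (S k \<times> S k) = (n choose k)\<^sup>2" for k
    unfolding S_def by (simp add: card_cartesian_product n_subsets power2_eq_square)
  ultimately show ?thesis by (simp only:)
qed

text \<open>The type changes of a merge, read off from the set \<open>P\<close> of positions (or values) of its first
  part. This form makes it possible to count such sets without reference to a
  permutation.\<close>
definition changes :: "nat \<Rightarrow> nat set \<Rightarrow> nat set" where
  "changes n P = {c. 1 \<le> c \<and> c < n \<and> (c \<in> P \<longleftrightarrow> c + 1 \<notin> P)}"

lemma changes_subset_type_changes:
  assumes "is_merge \<alpha> \<beta> a b \<pi>" and "\<pi> \<in> perms n" and "k = fst \<or> k = snd"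
  shows "changes n (k ` a ` points \<alpha>) \<subseteq> type_changes k (a ` points \<alpha>) (b ` points \<beta>) \<pi>"
proof
  let ?P = "a ` points \<alpha>" and ?Q = "b ` points \<beta>"
  fix c assume "c \<in> changes n (k ` ?P)"
  then have c: "1 \<le> c" "c < n" "c \<in> k ` ?P \<longleftrightarrow> c + 1 \<notin> k ` ?P"
    unfolding changes_def by auto
  have Q: "k ` ?Q = {1..n} - k ` ?P"
    by (rule merge_coordinates_second[OF assms])
  have "\<exists>x\<in>?P \<union> ?Q. \<exists>y\<in>?P \<union> ?Q. k x = c \<and> k y = c + 1 \<and> differ_in_type ?P ?Q x y"
  proof (cases "c \<in> k ` ?P")
    case True
    then have y: "c + 1 \<in> k ` ?Q" using c Q by simp
    obtain x where x: "c = k x" "x \<in> ?P" using True by (rule imageE)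
    obtain y where "c + 1 = k y" "y \<in> ?Q" using y by (rule imageE)
    with x show ?thesis unfolding differ_in_type_def by (metis UnI1 UnI2)
  next
    case False
    then have xy: "c \<in> k ` ?Q" "c + 1 \<in> k ` ?P" using c Q by simp_all
    obtain x where x: "c = k x" "x \<in> ?Q" using xy(1) by (rule imageE)
    obtain y where "c + 1 = k y" "y \<in> ?P" using xy(2) by (rule imageE)
    with x show ?thesis unfolding differ_in_type_def by (metis UnI1 UnI2)
  qed
  moreover have "?P \<union> ?Q = points \<pi>"
    using assms(1) unfolding is_merge_def by blast
  ultimately show "c \<in> type_changes k ?P ?Q \<pi>"
    using c length_perms[OF assms(2)] unfolding type_changes_def by auto
qed

text \<open>Starting from the membership of \<open>1\<close>, the changes determine the membership of
  \<open>2, 3, \<dots>, n\<close> one after the other.\<close>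
lemma changes_inject:
  assumes "P \<subseteq> {1..n}" "P' \<subseteq> {1..n}" "changes n P = changes n P'" "1 \<in> P \<longleftrightarrow> 1 \<in> P'"
  shows "P = P'"
proof -
  have "Suc i \<le> n \<Longrightarrow> Suc i \<in> P \<longleftrightarrow> Suc i \<in> P'" for i
  proof (induction i)
    case 0
    then show ?case using assms(4) by simp
  next
    case (Suc i)
    have "Suc i \<in> changes n P \<longleftrightarrow> Suc i \<in> changes n P'"
      using assms(3) by simp
    then show ?case
      using Suc unfolding changes_def by auto
  qed
  then have "i \<in> P \<longleftrightarrow> i \<in> P'" if "i \<in> {1..n}" for i
    using that by (cases i) auto
  then show ?thesis
    using assms(1,2) by blast
qed

text \<open>Such a set is given by one bit and a set of at most \<open>B\<close> changes, and each of the \<open>B + 1\<close>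
  possible numbers \<open>j\<close> of changes allows at most \<open>n\<^sup>j \<le> n\<^sup>B\<close> of the latter.\<close>
lemma card_few_changes_le:
  assumes "n \<ge> 1"
  shows "card {P. P \<subseteq> {1..n} \<and> card (changes n P) \<le> B} \<le> 2 * (B + 1) * n ^ B"
proof -
  define F where "F = {P. P \<subseteq> {1..n} \<and> card (changes n P) \<le> B}"
  define T where "T j = {U. U \<subseteq> {1..n} \<and> card U = j}" for j
  have "card F \<le> card ((UNIV :: bool set) \<times> (\<Union>j\<le>B. T j))"
  proof (rule card_inj_on_le)
    show "inj_on (\<lambda>P. (1 \<in> P, changes n P)) F"
      unfolding F_def by (rule inj_onI) (use changes_inject in auto)
    have "changes n P \<subseteq> {1..n}" for P
      unfolding changes_def by auto
    then show "(\<lambda>P. (1 \<in> P, changes n P)) ` F \<subseteq> UNIV \<times> (\<Union>j\<le>B. T j)"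
      unfolding F_def T_def by auto
    show "finite ((UNIV :: bool set) \<times> (\<Union>j\<le>B. T j))"
      unfolding T_def by simp
  qed
  also have "\<dots> = 2 * card (\<Union>j\<le>B. T j)"
    by (simp add: card_cartesian_product)
  also have "card (\<Union>j\<le>B. T j) \<le> (\<Sum>j\<le>B. card (T j))"
    by (rule card_UN_le) simp
  also have "(\<Sum>j\<le>B. card (T j)) \<le> (\<Sum>j\<le>B. n ^ B)"
  proof (rule sum_mono)
    fix j assume "j \<in> {..B}"
    have "card (T j) = n choose j"
      unfolding T_def by (simp add: n_subsets)
    also have "\<dots> \<le> n ^ j"
      by (cases "j \<le> n") (simp_all add: binomial_le_pow binomial_eq_0)
    also have "\<dots> \<le> n ^ B"
      using assms \<open>j \<in> {..B}\<close> by (intro power_increasing) auto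
    finally show "card (T j) \<le> n ^ B" .
  qed
  finally show ?thesis
    unfolding F_def by (simp add: algebra_simps)
qed

text \<open>The bound \<open>B\<close> on the total number of type changes is used for positions and for values
  separately; the loss is only a polynomial factor.\<close>
lemma card_bounded_merge_class_le:
  assumes "perm_class C" and "perm_class D" and "n \<ge> 1"
  shows "card (bounded_merge_class B C D \<inter> perms n)
    \<le> (\<Sum>k\<le>n. card (C \<inter> perms k) * card (D \<inter> perms (n - k))) * (2 * (B + 1) * n ^ B)\<^sup>2"
proof -
  define F where "F = {P. P \<subseteq> {1..n} \<and> card (changes n P) \<le> B}"
  have "card (bounded_merge_class B C D \<inter> perms n)
    \<le> (\<Sum>k\<le>n. card (C \<inter> perms k) * card (D \<inter> perms (n - k)) * card (F \<times> F))"
  proof (rule card_merges_le[OF assms(1,2)])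
    show "finite (F \<times> F)"
      unfolding F_def by simp
    fix \<pi> assume \<pi>: "\<pi> \<in> bounded_merge_class B C D \<inter> perms n"
    then obtain \<alpha> \<beta> a b where *: "\<alpha> \<in> C" "\<beta> \<in> D" "is_merge \<alpha> \<beta> a b \<pi>"
      and le: "card (type_changes fst (a ` points \<alpha>) (b ` points \<beta>) \<pi>) +
        card (type_changes snd (a ` points \<alpha>) (b ` points \<beta>) \<pi>) \<le> B"
      unfolding bounded_merge_class_def by blast
    have "k ` a ` points \<alpha> \<in> F" if k: "k = fst \<or> k = snd" for k
    proof -
      have "finite (type_changes k (a ` points \<alpha>) (b ` points \<beta>) \<pi>)"
        by (rule finite_subset[of _ "{..length \<pi>}"]) (auto simp: type_changes_def)
      then have "card (changes n (k ` a ` points \<alpha>))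
          \<le> card (type_changes k (a ` points \<alpha>) (b ` points \<beta>) \<pi>)"
        using changes_subset_type_changes[OF *(3) _ k] \<pi> by (intro card_mono) auto
      also have "\<dots> \<le> B"
        using le k by (elim disjE) simp_all
      finally show ?thesis
        unfolding F_def using merge_coordinates_first(1)[OF *(3) _ k, of n] \<pi> by simp
    qed
    then have "(fst ` a ` points \<alpha>, snd ` a ` points \<alpha>) \<in> F \<times> F"
      by simp
    with * show "\<exists>\<alpha>\<in>C. \<exists>\<beta>\<in>D. \<exists>a b. is_merge \<alpha> \<beta> a b \<pi> \<and>
        (fst ` a ` points \<alpha>, snd ` a ` points \<alpha>) \<in> F \<times> F"
      by - (rule bexI[of _ \<alpha>], rule bexI[of _ \<beta>], rule exI[of _ a], rule exI[of _ b],
            rule conjI, assumption+)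
  qed simp
  also have "\<dots> = (\<Sum>k\<le>n. card (C \<inter> perms k) * card (D \<inter> perms (n - k))) * (card F)\<^sup>2"
    by (simp add: card_cartesian_product sum_distrib_right power2_eq_square)
  also have "\<dots> \<le> (\<Sum>k\<le>n. card (C \<inter> perms k) * card (D \<inter> perms (n - k)))
      * (2 * (B + 1) * n ^ B)\<^sup>2"
    unfolding F_def using card_few_changes_le[OF assms(3)]
    by (intro mult_left_mono power_mono) auto
  finally show ?thesis .
qed

section \<open>Growth rates and exponential bounds\<close>

lemma growth_rate_nonneg: "0 \<le> growth_rate C"
  unfolding growth_rate_def
  by (rule le_Limsup) (simp_all add: real_root_ge_zero)

lemma growth_rate_mono:
  assumes "C \<subseteq> D"
  shows "growth_rate C \<le> growth_rate D"
  unfolding growth_rate_def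
proof (rule Limsup_mono, rule eventually_sequentiallyI[of 1])
  fix n :: nat assume "1 \<le> n"
  moreover have "card (C \<inter> perms n) \<le> card (D \<inter> perms n)"
    using assms finite_perms by (intro card_mono) auto
  ultimately show "ereal (root n (real (card (C \<inter> perms n))))
      \<le> ereal (root n (real (card (D \<inter> perms n))))"
    by simp
qed

text \<open>The \<open>n\<close>-th roots are eventually below \<open>x\<close>; the constant \<open>K\<close> absorbs the finitely many
  exceptions, so that the bound holds for every length and can be used inside sums over all
  splittings \<open>n = k + (n - k)\<close>.\<close>
lemma growth_rate_lessD:
  assumes "growth_rate C < ereal x"
  obtains K where "0 < K" and "\<And>n. real (card (C \<inter> perms n)) \<le> K * x ^ n"
proof -
  have "0 < ereal x"
    using growth_rate_nonneg assms by (rule le_less_trans)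
  then have x: "0 < x" by simp
  define c where "c n = real (card (C \<inter> perms n))" for n
  have "\<forall>\<^sub>F n in sequentially. ereal (root n (c n)) < ereal x"
    using assms unfolding growth_rate_def c_def by (rule Limsup_lessD)
  then obtain N where N: "\<And>n. n \<ge> N \<Longrightarrow> root n (c n) < x"
    by (auto simp: eventually_sequentially)
  define K where "K = 1 + (\<Sum>i\<le>N. c i / x ^ i)"
  have nn: "0 \<le> (\<Sum>i\<le>N. c i / x ^ i)"
    using x by (intro sum_nonneg) (simp add: c_def)
  have "c n \<le> K * x ^ n" for n
  proof (cases "n \<le> N")
    case True
    then have "c n / x ^ n \<le> (\<Sum>i\<le>N. c i / x ^ i)"
      using x by (intro member_le_sum[of n "{..N}" "\<lambda>i. c i / x ^ i"]) (auto simp: c_def)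
    then have "c n / x ^ n \<le> K" by (simp add: K_def)
    then show ?thesis using x by (simp add: divide_simps)
  next
    case False
    then have "c n = root n (c n) ^ n"
      by (simp add: c_def)
    also have "\<dots> \<le> x ^ n"
      using N[of n] False by (intro power_mono) (auto simp: c_def real_root_ge_zero)
    also have "\<dots> \<le> K * x ^ n"
      using x nn by (simp add: K_def)
    finally show ?thesis .
  qed
  then show thesis
    using that[of K] nn by (simp add: K_def c_def)
qed

text \<open>The \<open>n\<close>-th roots of \<open>K\<close> and of \<open>n\<^sup>m\<close> tend to \<open>1\<close>.\<close>
lemma growth_rate_leI:
  assumes "0 < K" and "0 \<le> x"
    and bound: "\<And>n. n \<ge> 1 \<Longrightarrow> real (card (C \<inter> perms n)) \<le> K * real n ^ m * x ^ n"
  shows "growth_rate C \<le> ereal x"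
proof -
  have "(\<lambda>n. root n K * root n (real n) ^ m * x) \<longlonglongrightarrow> 1 * 1 ^ m * x"
    by (intro tendsto_intros LIMSEQ_root LIMSEQ_root_const assms(1))
  then have lim: "limsup (\<lambda>n. ereal (root n K * root n (real n) ^ m * x)) = ereal x"
    by (intro lim_imp_Limsup) simp_all
  have "growth_rate C \<le> limsup (\<lambda>n. ereal (root n K * root n (real n) ^ m * x))"
    unfolding growth_rate_def
  proof (rule Limsup_mono, rule eventually_sequentiallyI[of 1])
    fix n :: nat assume n: "1 \<le> n"
    then have "root n (real (card (C \<inter> perms n))) \<le> root n (K * real n ^ m * x ^ n)"
      using bound by simp
    also have "\<dots> = root n K * root n (real n) ^ m * x"
      using n assms(2) by (simp add: real_root_mult real_root_power real_root_power_cancel)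
    finally show "ereal (root n (real (card (C \<inter> perms n))))
        \<le> ereal (root n K * root n (real n) ^ m * x)"
      by simp
  qed
  with lim show ?thesis by simp
qed

section \<open>Growth rates of merges\<close>

lemma sum_squares_le_square_sum:
  fixes f :: "'a \<Rightarrow> real"
  assumes "finite A" and "\<And>x. x \<in> A \<Longrightarrow> 0 \<le> f x"
  shows "(\<Sum>x\<in>A. (f x)\<^sup>2) \<le> (\<Sum>x\<in>A. f x)\<^sup>2"
proof -
  have "(\<Sum>x\<in>A. (f x)\<^sup>2) \<le> (\<Sum>x\<in>A. f x * (\<Sum>y\<in>A. f y))"
    unfolding power2_eq_square
    using assms by (intro sum_mono mult_left_mono member_le_sum) auto
  then show ?thesis
    by (simp add: power2_eq_square sum_distrib_right)
qed

text \<open>Each summand \<open>x\<^sup>k y\<^sup>n\<^sup>-\<^sup>k (n choose k)\<^sup>2\<close> is the square of a summand in the binomial expansion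
  of \<open>(\<surd>x + \<surd>y)\<^sup>n\<close>.\<close>
lemma growth_rate_merge_class_le:
  assumes C: "perm_class C" and D: "perm_class D"
    and x: "growth_rate C < ereal x" and y: "growth_rate D < ereal y"
  shows "growth_rate (merge_class C D) \<le> ereal ((sqrt x + sqrt y)\<^sup>2)"
proof -
  obtain K where K: "0 < K" "\<And>n. real (card (C \<inter> perms n)) \<le> K * x ^ n"
    using growth_rate_lessD[OF x] by blast
  obtain L where L: "0 < L" "\<And>n. real (card (D \<inter> perms n)) \<le> L * y ^ n"
    using growth_rate_lessD[OF y] by blast
  have "0 < ereal x" "0 < ereal y"
    using growth_rate_nonneg x y by (blast intro: le_less_trans)+
  then have pos: "0 < x" "0 < y" by simp_all
  have sq: "(sqrt x ^ k)\<^sup>2 = x ^ k" "(sqrt y ^ k)\<^sup>2 = y ^ k" for k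
    using pos by (metis less_imp_le mult.commute power_mult real_sqrt_pow2)+
  show ?thesis
  proof (rule growth_rate_leI[of "K * L" _ _ 0])
    fix n :: nat
    have "real (card (merge_class C D \<inter> perms n))
        \<le> real (\<Sum>k\<le>n. card (C \<inter> perms k) * card (D \<inter> perms (n - k)) * (n choose k)\<^sup>2)"
      using card_merge_class_le[OF C D] by (simp only: of_nat_le_iff)
    also have "\<dots> = (\<Sum>k\<le>n. real (card (C \<inter> perms k)) * real (card (D \<inter> perms (n - k)))
        * (real (n choose k))\<^sup>2)"
      by simp
    also have "\<dots> \<le> (\<Sum>k\<le>n. (K * x ^ k) * (L * y ^ (n - k)) * (real (n choose k))\<^sup>2)"
      using K L pos by (intro sum_mono mult_right_mono mult_mono) auto
    also have "\<dots> = K * L * (\<Sum>k\<le>n. (real (n choose k) * sqrt x ^ k * sqrt y ^ (n - k))\<^sup>2)"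
      by (simp only: power_mult_distrib sq sum_distrib_left mult_ac)
    also have "\<dots> \<le> K * L * (\<Sum>k\<le>n. real (n choose k) * sqrt x ^ k * sqrt y ^ (n - k))\<^sup>2"
      using K L pos by (intro mult_left_mono sum_squares_le_square_sum) auto
    also have "(\<Sum>k\<le>n. real (n choose k) * sqrt x ^ k * sqrt y ^ (n - k)) = (sqrt x + sqrt y) ^ n"
      by (simp add: binomial_ring)
    finally show "real (card (merge_class C D \<inter> perms n))
        \<le> K * L * real n ^ 0 * ((sqrt x + sqrt y)\<^sup>2) ^ n"
      by (simp only: power_0 mult_1_right power_mult[symmetric] mult.commute[of n 2])
  qed (use K L in auto)
qed

text \<open>With a common base \<open>x\<close> for both classes, all \<open>n + 1\<close> terms of the convolution have the
  same bound \<open>K L x\<^sup>n\<close>, so the whole count is at most \<open>x\<^sup>n\<close> times a polynomial in \<open>n\<close>.\<close>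
lemma growth_rate_bounded_merge_class_le:
  assumes C: "perm_class C" and D: "perm_class D"
    and x: "growth_rate C < ereal x" and y: "growth_rate D < ereal x"
  shows "growth_rate (bounded_merge_class B C D) \<le> ereal x"
proof -
  obtain K where K: "0 < K" "\<And>n. real (card (C \<inter> perms n)) \<le> K * x ^ n"
    using growth_rate_lessD[OF x] by blast
  obtain L where L: "0 < L" "\<And>n. real (card (D \<inter> perms n)) \<le> L * x ^ n"
    using growth_rate_lessD[OF y] by blast
  have "0 < ereal x"
    using growth_rate_nonneg x by (rule le_less_trans)
  then have pos: "0 < x" by simp
  let ?q = "real (2 * (B + 1))"
  show ?thesis
  proof (rule growth_rate_leI[of "K * L * 2 * ?q\<^sup>2" _ _ "2 * B + 1"])
    fix n :: nat assume n: "n \<ge> 1"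
    have "real (card (bounded_merge_class B C D \<inter> perms n))
        \<le> real ((\<Sum>k\<le>n. card (C \<inter> perms k) * card (D \<inter> perms (n - k))) * (2 * (B + 1) * n ^ B)\<^sup>2)"
      using card_bounded_merge_class_le[OF C D n] by (simp only: of_nat_le_iff)
    also have "\<dots> = (\<Sum>k\<le>n. real (card (C \<inter> perms k)) * real (card (D \<inter> perms (n - k))))
        * (?q * real n ^ B)\<^sup>2"
      by (simp only: of_nat_mult of_nat_power of_nat_sum)
    also have "\<dots> \<le> (\<Sum>k\<le>n. (K * x ^ k) * (L * x ^ (n - k))) * (?q * real n ^ B)\<^sup>2"
      using K L pos by (intro mult_right_mono sum_mono mult_mono) auto
    also have "(\<Sum>k\<le>n. (K * x ^ k) * (L * x ^ (n - k))) = (\<Sum>k\<le>n. K * L * x ^ n)"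
    proof (rule sum.cong)
      fix k assume "k \<in> {..n}"
      then have "x ^ n = x ^ k * x ^ (n - k)"
        by (simp flip: power_add)
      then show "(K * x ^ k) * (L * x ^ (n - k)) = K * L * x ^ n"
        by (simp add: mult_ac)
    qed simp
    also have "\<dots> = real (n + 1) * (K * L * x ^ n)"
      by simp
    \<comment> \<open>Since \<open>n \<ge> 1\<close>, the factor \<open>n + 1\<close> is at most \<open>2 n\<close>; this leaves a pure power of \<open>n\<close>.\<close>
    also have "\<dots> * (?q * real n ^ B)\<^sup>2 \<le> (2 * real n) * (K * L * x ^ n) * (?q * real n ^ B)\<^sup>2"
      using K L pos n by (intro mult_right_mono) auto
    also have "\<dots> = K * L * 2 * ?q\<^sup>2 * real n ^ (2 * B + 1) * x ^ n"
    proof -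
      have "real n ^ (2 * B + 1) = (real n ^ B)\<^sup>2 * real n"
        by (metis Suc_eq_plus1 mult.commute power_Suc power_mult)
      moreover have "(2 * r) * (u * z) * (q * p)\<^sup>2 = u * 2 * q\<^sup>2 * (p\<^sup>2 * r) * z"
        for r u z q p :: real
        by algebra
      ultimately show ?thesis
        by (simp only:)
    qed
    finally show "real (card (bounded_merge_class B C D \<inter> perms n))
        \<le> K * L * 2 * ?q\<^sup>2 * real n ^ (2 * B + 1) * x ^ n" .
  qed (use K L pos in auto)
qed

lemma Nil_in_perm_class:
  assumes "perm_class C" and "C \<noteq> {}"
  shows "[] \<in> C"
proof -
  obtain \<pi> where "\<pi> \<in> C" using assms(2) by blast
  moreover have "[] \<in> perms 0"
    unfolding perms_def by simp
  moreover have "involved [] \<pi>"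
    unfolding involved_def embedding_def points_def by simp
  ultimately show ?thesis
    using assms(1) unfolding perm_class_def by blast
qed

text \<open>A permutation in one class is the merge of itself with the empty permutation, which
  belongs to the other class, and in this merge all points have the same type.\<close>
lemma subset_bounded_merge_class:
  assumes "perm_class C" and "perm_class D" and "C \<noteq> {}" and "D \<noteq> {}"
  shows "C \<union> D \<subseteq> bounded_merge_class B C D"
proof
  fix \<pi> assume "\<pi> \<in> C \<union> D"
  have e: "points [] = {}"
    unfolding points_def by simp
  have no_changes: "type_changes k P {} \<pi> = {}" "type_changes k {} P \<pi> = {}" for k P
    unfolding type_changes_def differ_in_type_def by simp_all
  have merges: "is_merge \<pi> [] id id \<pi>" "is_merge [] \<pi> id id \<pi>"
    unfolding is_merge_def embedding_def e by simp_all
  have Nil: "[] \<in> C" "[] \<in> D"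
    using Nil_in_perm_class assms by blast+
  have "\<exists>\<alpha>\<in>C. \<exists>\<beta>\<in>D. is_merge \<alpha> \<beta> id id \<pi> \<and>
      type_changes fst (id ` points \<alpha>) (id ` points \<beta>) \<pi> = {} \<and>
      type_changes snd (id ` points \<alpha>) (id ` points \<beta>) \<pi> = {}"
    using \<open>\<pi> \<in> C \<union> D\<close>
  proof
    assume "\<pi> \<in> C"
    then show ?thesis
      using Nil(2) merges(1) no_changes(1) e by (intro bexI[of _ \<pi>] bexI[of _ "[]"]) simp_all
  next
    assume "\<pi> \<in> D"
    then show ?thesis
      using Nil(1) merges(2) no_changes(2) e by (intro bexI[of _ "[]"] bexI[of _ \<pi>]) simp_all
  qed
  then obtain \<alpha> \<beta> where *: "\<alpha> \<in> C" "\<beta> \<in> D" "is_merge \<alpha> \<beta> id id \<pi>"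
    and "type_changes fst (id ` points \<alpha>) (id ` points \<beta>) \<pi> = {}"
      "type_changes snd (id ` points \<alpha>) (id ` points \<beta>) \<pi> = {}"
    by blast
  then have "card (type_changes fst (id ` points \<alpha>) (id ` points \<beta>) \<pi>) +
     card (type_changes snd (id ` points \<alpha>) (id ` points \<beta>) \<pi>) \<le> B"
    by simp
  with * have "\<exists>\<alpha>\<in>C. \<exists>\<beta>\<in>D. \<exists>a b. is_merge \<alpha> \<beta> a b \<pi> \<and>
      card (type_changes fst (a ` points \<alpha>) (b ` points \<beta>) \<pi>) +
      card (type_changes snd (a ` points \<alpha>) (b ` points \<beta>) \<pi>) \<le> B"
    by - (rule bexI[of _ \<alpha>], rule bexI[of _ \<beta>], rule exI[of _ id], rule exI[of _ id],
          rule conjI, assumption+)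
  moreover have "\<pi> \<in> (\<Union>n. perms n)"
    using \<open>\<pi> \<in> C \<union> D\<close> assms(1,2) unfolding perm_class_def by blast
  ultimately show "\<pi> \<in> bounded_merge_class B C D"
    unfolding bounded_merge_class_def by blast
qed

lemma growth_rate_cases:
  obtains (infinite) "growth_rate C = \<infinity>" | (real) r where "growth_rate C = ereal r" "0 \<le> r"
  using growth_rate_nonneg[of C] by (cases "growth_rate C") auto

lemma ereal_sqrt_infinity: "ereal_sqrt \<infinity> = \<infinity>"
  using ereal_sqrt.simps(2) by (simp only: infinity_ereal_def)

theorem theorem4:
  fixes B :: nat and C D :: "nat list set"
  assumes "B \<ge> 1" and "perm_class C" and "perm_class D"
  shows "growth_rate (merge_class C D)
           \<le> (ereal_sqrt (growth_rate C) + ereal_sqrt (growth_rate D))\<^sup>2 \<and>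
         (C \<noteq> {} \<and> D \<noteq> {} \<longrightarrow>
           growth_rate (bounded_merge_class B C D) = max (growth_rate C) (growth_rate D))"
proof (intro conjI impI antisym)
  show "growth_rate (merge_class C D)
      \<le> (ereal_sqrt (growth_rate C) + ereal_sqrt (growth_rate D))\<^sup>2"
  proof (cases C rule: growth_rate_cases)
    case infinite
    then show ?thesis
      by (cases D rule: growth_rate_cases) (simp_all add: ereal_sqrt_infinity)
  next
    case (real c)
    note c = real
    show ?thesis
    proof (cases D rule: growth_rate_cases)
      case infinite
      with c show ?thesis
        by (simp add: ereal_sqrt_infinity)
    next
      case (real d)
      \<comment> \<open>The bound holds for every base above the growth rates; let the excess \<open>e\<close> tend to \<open>0\<close>.\<close>
      have "growth_rate (merge_class C D) \<le> ereal ((sqrt (c + e) + sqrt (d + e))\<^sup>2)"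
        if "0 < e" for e
        using growth_rate_merge_class_le[OF assms(2,3), of "c + e" "d + e"] c real that by simp
      then have "\<forall>\<^sub>F e in at_right 0.
          growth_rate (merge_class C D) \<le> ereal ((sqrt (c + e) + sqrt (d + e))\<^sup>2)"
        by (auto simp: eventually_at_right_less intro: eventually_mono[OF eventually_at_right_less])
      moreover have "((\<lambda>e. (sqrt (c + e) + sqrt (d + e))\<^sup>2) \<longlongrightarrow> (sqrt (c + 0) + sqrt (d + 0))\<^sup>2)
          (at_right 0)"
        by (intro tendsto_intros)
      ultimately have "growth_rate (merge_class C D) \<le> ereal ((sqrt c + sqrt d)\<^sup>2)"
        by (intro tendsto_lowerbound[of "\<lambda>e. ereal ((sqrt (c + e) + sqrt (d + e))\<^sup>2)"]) auto
      then show ?thesis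
        using c real by simp
    qed
  qed
next
  show "growth_rate (bounded_merge_class B C D) \<le> max (growth_rate C) (growth_rate D)"
  proof (rule dense_ge)
    fix z assume z: "max (growth_rate C) (growth_rate D) < z"
    show "growth_rate (bounded_merge_class B C D) \<le> z"
    proof (cases z)
      case (real x)
      then show ?thesis
        using growth_rate_bounded_merge_class_le[OF assms(2,3), of x B] z by simp
    qed (use z in auto)
  qed
next
  assume "C \<noteq> {} \<and> D \<noteq> {}"
  then have "C \<subseteq> bounded_merge_class B C D" "D \<subseteq> bounded_merge_class B C D"
    using subset_bounded_merge_class[OF assms(2,3), of B] by auto
  then show "max (growth_rate C) (growth_rate D) \<le> growth_rate (bounded_merge_class B C D)"
    using growth_rate_mono by simp
qed

end
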